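(* Let $X$ and $Y$ be compact metric spaces, and let $E$ be a smooth reflexive Banach space which is $2$-iso-reflexive. Suppose that $\Delta$ is a $2$-local standard isometry from $\mathrm{Lip}(X,E)$ to $\mathrm{Lip}(Y,E)$. Then there exist a Lipschitz homeomorphism $\psi$ from $Y$ onto $X$ and a continuous map $V$ from $Y$ into $(\mathrm{Iso}(E),\mathrm{SOT})$ such that $$\Delta(f)(y)=V(y)(f(\psi(y))),\quad\forall y\in Y,\ f\in\mathrm{Lip}(X,E).$$ Moreover, $\Delta$ is a surjective linear isometry.
   Context: Banach spaces are over $\mathbb{K}=\mathbb{R}$ or $\mathbb{C}$ (the same field throughout). For a metric space $X$ and a normed space $E$, $\mathrm{Lip}(X,E)$ is the space of all bounded Lipschitz functions $f\colon X\to E$ with norm $\|f\|_L=\max\{L(f),\|f\|_\infty\}$, where $L(f)$ is the Lipschitz constant of $f$ and $\|f\|_\infty$ is its uniform norm. For normed spaces $E,F$, $\mathrm{Iso}(E,F)$ is the set of all surjective linear isometries from $E$ onto $F$, and $\mathrm{Iso}(E)=\mathrm{Iso}(E,E)$. $\mathrm{SOT}$ denotes the strong operator topology. A (not necessarily linear or continuous) map $\Delta\colon E\to E$ is a $2$-local isometry if for all $x,y\in E$ there exists $T_{x,y}\in\mathrm{Iso}(E)$ such that $\Delta(x)=T_{x,y}(x)$ and $\Delta(y)=T_{x,y}(y)$. A Banach space $E$ is $2$-iso-reflexive if every $2$-local isometry $E\to E$ is both linear and surjective. A normed space $E$ is smooth if for each $e\in E$ with $\|e\|=1$ there is a unique $e^*\in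 E^*$ with $\|e^*\|=1$ and $e^*(e)=1$. For metric spaces $X,Y$, a bijection $\varphi\colon Y\to X$ preserves distances less than $2$ if $d(\varphi(x),\varphi(y))=d(x,y)$ whenever $d(x,y)<2$. $\mathrm{Iso}_{<2}(Y,X)$ is the set of all bijections $\varphi\colon Y\to X$ such that both $\varphi$ and $\varphi^{-1}$ preserve distances less than $2$. The $2$-components of $Y$ are the equivalence classes of the relation: $y\sim y'$ iff there are $y=y_0,y_1,\dots,y_n=y'$ in $Y$ with $d(y_{i-1},y_i)<2$ for all $i$. A map $T\colon\mathrm{Lip}(X,E)\to\mathrm{Lip}(Y,F)$ is a standard isometry if there exist $\varphi\in\mathrm{Iso}_{<2}(Y,X)$ and a map $J\colon Y\to\mathrm{Iso}(E,F)$ constant on each $2$-component of $Y$ such that $T(f)(y)=J(y)(f(\varphi(y)))$ for all $f\in\mathrm{Lip}(X,E)$ and $y\in Y$. A (not necessarily linear or continuous) map $\Delta\colon\mathrm{Lip}(X,E)\to\mathrm{Lip}(Y,F)$ is a $2$-local standard isometry if for all $f,g\in\mathrm{Lip}(X,E)$ there is a standard isometry $T_{f,g}\colon\mathrm{Lip}(X,E)\to\mathrm{Lip}(Y,F)$, depending on $f$ and $g$, with $\Delta(f)=T_{f,g}(f)$ and $\Delta(g)=T_{f,g}(g)$. A Lipschitz homeomorphism is a bijection $\varphi$ such that both $\varphi$ and $\varphi^{-1}$ are Lipschitz. *)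

theory Defs
  imports "HOL-Analysis.Analysis"
begin

section \<open>Normed spaces over the reals or the complex numbers\<close>

text \<open>The two cases of the scalar field are treated uniformly: the instances of the following class
  are exactly the isometric copies of the fields of real and of complex numbers.\<close>

class real_or_complex = real_normed_field +
  assumes real_or_complex:
    "(\<forall>z. \<exists>a. z = a *\<^sub>R 1) \<or>
     (\<exists>i. i * i = - 1 \<and>
        (\<forall>z. \<exists>a b. z = a *\<^sub>R 1 + b *\<^sub>R i \<and> norm z = sqrt (a\<^sup>2 + b\<^sup>2)))"

instance real :: real_or_complex
  by standard auto

instance complex :: real_or_complex
proof
  have "z = Re z *\<^sub>R 1 + Im z *\<^sub>R \<i> \<and> cmod z = sqrt ((Re z)\<^sup>2 + (Im z)\<^sup>2)" for z
    by (simp add: complex_eq_iff cmod_def)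
  moreover have "\<i> * \<i> = - 1"
    by simp
  ultimately show "(\<forall>z::complex. \<exists>a. z = a *\<^sub>R 1) \<or>
     (\<exists>i::complex. i * i = - 1 \<and>
        (\<forall>z. \<exists>a b. z = a *\<^sub>R 1 + b *\<^sub>R i \<and> norm z = sqrt (a\<^sup>2 + b\<^sup>2)))"
    by blast
qed

text \<open>The real structure of the type class is the restriction of the given scalar multiplication.\<close>

locale normed_space_over = vector_space scale
  for scale :: "'k::real_or_complex \<Rightarrow> 'e::real_normed_vector \<Rightarrow> 'e" +
  assumes scale_of_real: "scale (of_real r) x = r *\<^sub>R x"
    and norm_scale: "norm (scale c x) = norm c * norm x"

definition Iso ::
  "('k::real_or_complex \<Rightarrow> 'e::real_normed_vector \<Rightarrow> 'e) \<Rightarrow>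
   ('k \<Rightarrow> 'f::real_normed_vector \<Rightarrow> 'f) \<Rightarrow> ('e \<Rightarrow> 'f) set" where
  "Iso sE sF =
    {T. Vector_Spaces.linear sE sF T \<and> surj T \<and> (\<forall>x. norm (T x) = norm x)}"

text \<open>Every element of \<open>Iso sE sE\<close> is a bounded real-linear operator, so \<open>Blinfun\<close> identifies it
  with an element of the space that carries the library's strong operator topology.\<close>

definition SOT_Iso ::
  "('k::real_or_complex \<Rightarrow> 'e::real_normed_vector \<Rightarrow> 'e) \<Rightarrow> ('e \<Rightarrow> 'e) topology" where
  "SOT_Iso sE = pullback_topology (Iso sE sE) Blinfun strong_operator_topology"

lemma topspace_SOT_Iso [simp]: "topspace (SOT_Iso sE) = Iso sE sE"
  by (simp add: SOT_Iso_def topspace_pullback_topology strong_operator_topology_topspace)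

definition two_local_isometry ::
  "('k::real_or_complex \<Rightarrow> 'e::real_normed_vector \<Rightarrow> 'e) \<Rightarrow> ('e \<Rightarrow> 'e) \<Rightarrow> bool" where
  "two_local_isometry sE D \<longleftrightarrow> (\<forall>x y. \<exists>T\<in>Iso sE sE. D x = T x \<and> D y = T y)"

definition two_iso_reflexive ::
  "('k::real_or_complex \<Rightarrow> 'e::real_normed_vector \<Rightarrow> 'e) \<Rightarrow> bool" where
  "two_iso_reflexive sE \<longleftrightarrow>
    (\<forall>D. two_local_isometry sE D \<longrightarrow> Vector_Spaces.linear sE sE D \<and> surj D)"

definition dual_space ::
  "('k::real_or_complex \<Rightarrow> 'e::real_normed_vector \<Rightarrow> 'e) \<Rightarrow> ('e \<Rightarrow> 'k) set" where
  "dual_space sE = {u. Vector_Spaces.linear sE (*) u \<and> bounded_linear u}"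

definition smooth_space ::
  "('k::real_or_complex \<Rightarrow> 'e::real_normed_vector \<Rightarrow> 'e) \<Rightarrow> bool" where
  "smooth_space sE \<longleftrightarrow>
    (\<forall>e. norm e = 1 \<longrightarrow> (\<exists>!u. u \<in> dual_space sE \<and> onorm u = 1 \<and> u e = 1))"

text \<open>Elements of the bidual are functions on all of \<^typ>\<open>'e \<Rightarrow> 'k\<close>, of which only the values on
  \<^const>\<open>dual_space\<close> matter.\<close>

definition bidual_space ::
  "('k::real_or_complex \<Rightarrow> 'e::real_normed_vector \<Rightarrow> 'e) \<Rightarrow> (('e \<Rightarrow> 'k) \<Rightarrow> 'k) set" where
  "bidual_space sE =
    {\<Phi>. (\<forall>u\<in>dual_space sE. \<forall>v\<in>dual_space sE. \<Phi> (\<lambda>x. u x + v x) = \<Phi> u + \<Phi> v) \<and>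
        (\<forall>c. \<forall>u\<in>dual_space sE. \<Phi> (\<lambda>x. c * u x) = c * \<Phi> u) \<and>
        (\<exists>M. \<forall>u\<in>dual_space sE. norm (\<Phi> u) \<le> M * onorm u)}"

definition reflexive_space ::
  "('k::real_or_complex \<Rightarrow> 'e::real_normed_vector \<Rightarrow> 'e) \<Rightarrow> bool" where
  "reflexive_space sE \<longleftrightarrow> (\<forall>\<Phi>\<in>bidual_space sE. \<exists>x. \<forall>u\<in>dual_space sE. \<Phi> u = u x)"

section \<open>Spaces of Lipschitz functions\<close>

definition Lip :: "('x::metric_space \<Rightarrow> 'e::real_normed_vector) set" where
  "Lip = {f. bounded (range f) \<and> (\<exists>C. C-lipschitz_on UNIV f)}"

definition Lip_const :: "('x::metric_space \<Rightarrow> 'e::real_normed_vector) \<Rightarrow> real" where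
  "Lip_const f = Inf {C. C-lipschitz_on UNIV f}"

definition Lip_norm :: "('x::metric_space \<Rightarrow> 'e::real_normed_vector) \<Rightarrow> real" where
  "Lip_norm f = max (Lip_const f) (SUP x. norm (f x))"

text \<open>Maps between spaces of Lipschitz functions are represented by functions on all of
  \<^typ>\<open>'x \<Rightarrow> 'e\<close>, of which only the values on \<^const>\<open>Lip\<close> matter.\<close>

definition Lip_surj_linear_isometry ::
  "('k::real_or_complex \<Rightarrow> 'e::real_normed_vector \<Rightarrow> 'e) \<Rightarrow>
   ('k \<Rightarrow> 'f::real_normed_vector \<Rightarrow> 'f) \<Rightarrow>
   (('x::metric_space \<Rightarrow> 'e) \<Rightarrow> ('y::metric_space \<Rightarrow> 'f)) \<Rightarrow> bool" where
  "Lip_surj_linear_isometry sE sF T \<longleftrightarrow>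
    T ` Lip = Lip \<and>
    (\<forall>f\<in>Lip. \<forall>g\<in>Lip. T (\<lambda>x. f x + g x) = (\<lambda>y. T f y + T g y)) \<and>
    (\<forall>c. \<forall>f\<in>Lip. T (\<lambda>x. sE c (f x)) = (\<lambda>y. sF c (T f y))) \<and>
    (\<forall>f\<in>Lip. Lip_norm (T f) = Lip_norm f)"

section \<open>Standard isometries\<close>

definition preserves_dist_less_2 :: "('y::metric_space \<Rightarrow> 'x::metric_space) \<Rightarrow> bool" where
  "preserves_dist_less_2 \<phi> \<longleftrightarrow> (\<forall>x y. dist x y < 2 \<longrightarrow> dist (\<phi> x) (\<phi> y) = dist x y)"

definition Iso_less_2 :: "('y::metric_space \<Rightarrow> 'x::metric_space) set" where
  "Iso_less_2 = {\<phi>. bij \<phi> \<and> preserves_dist_less_2 \<phi> \<and> preserves_dist_less_2 (inv \<phi>)}"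

definition two_components :: "'y::metric_space set set" where
  "two_components = UNIV // {(y, y'). dist y y' < 2}\<^sup>*"

definition standard_isometry ::
  "('k::real_or_complex \<Rightarrow> 'e::real_normed_vector \<Rightarrow> 'e) \<Rightarrow>
   ('k \<Rightarrow> 'f::real_normed_vector \<Rightarrow> 'f) \<Rightarrow>
   (('x::metric_space \<Rightarrow> 'e) \<Rightarrow> ('y::metric_space \<Rightarrow> 'f)) \<Rightarrow> bool" where
  "standard_isometry sE sF T \<longleftrightarrow>
    T \<in> Lip \<rightarrow> Lip \<and>
    (\<exists>\<phi>\<in>Iso_less_2. \<exists>J. (\<forall>y. J y \<in> Iso sE sF) \<and> (\<forall>C\<in>two_components. J constant_on C) \<and>
       (\<forall>f\<in>Lip. \<forall>y. T f y = J y (f (\<phi> y))))"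

definition two_local_standard_isometry ::
  "('k::real_or_complex \<Rightarrow> 'e::real_normed_vector \<Rightarrow> 'e) \<Rightarrow>
   ('k \<Rightarrow> 'f::real_normed_vector \<Rightarrow> 'f) \<Rightarrow>
   (('x::metric_space \<Rightarrow> 'e) \<Rightarrow> ('y::metric_space \<Rightarrow> 'f)) \<Rightarrow> bool" where
  "two_local_standard_isometry sE sF D \<longleftrightarrow>
    D \<in> Lip \<rightarrow> Lip \<and>
    (\<forall>f\<in>Lip. \<forall>g\<in>Lip. \<exists>T. standard_isometry sE sF T \<and> D f = T f \<and> D g = T g)"

definition Lipschitz_homeomorphism :: "('y::metric_space \<Rightarrow> 'x::metric_space) \<Rightarrow> bool" where
  "Lipschitz_homeomorphism \<psi> \<longleftrightarrow>
    bij \<psi> \<and> (\<exists>C. C-lipschitz_on UNIV \<psi>) \<and> (\<exists>C. C-lipschitz_on UNIV (inv \<psi>))"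

end

theory Submission
  imports Defs
begin

text \<open>The idea is that a function whose norm has a strict maximum at a point detects this point. For
  \<open>x \<in> X\<close> and \<open>a \<noteq> 0\<close> the norm of the cone-shaped function \<open>peak x a\<close> is maximal exactly at \<open>x\<close>, with
  value \<open>a\<close> there. Its image under \<open>\<Delta>\<close> is obtained by composing with some bijection \<open>\<phi>\<close> and applying
  isometries of \<open>E\<close> pointwise, so its norm is maximal exactly at \<open>\<phi>\<inverse> x\<close>. Comparing two such functions
  with the same \<open>x\<close> by 2-locality shows that this point \<open>\<sigma> x\<close> does not depend on \<open>a\<close>; comparing two
  with different centres shows that \<open>\<sigma>\<close> preserves the truncated metric \<open>min (dist x y) 2\<close>. Since \<open>Y\<close> is
  compact, such a map must be onto, whence \<open>\<psi> = \<sigma>\<inverse>\<close> is a Lipschitz homeomorphism.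

  Next, let \<open>f \<in> Lip(X,E)\<close> and \<open>a = f x \<noteq> 0\<close>. Comparing \<open>f\<close> with \<open>peak x a\<close> forces the bijection that
  serves both to send \<open>\<sigma> x\<close> to \<open>x\<close>, so that \<open>\<Delta> f\<close> and \<open>\<Delta> (peak x a)\<close> agree at \<open>\<sigma> x\<close>. Applying this also
  to the constant function \<open>a\<close> yields \<open>\<Delta> f (\<sigma> x) = V (\<sigma> x) (f x)\<close>, where \<open>V y a\<close> is the value at \<open>y\<close> of
  the image of the constant function \<open>a\<close>. Each \<open>V y\<close> is a 2-local isometry of \<open>E\<close>, hence a surjective
  linear isometry by 2-iso-reflexivity.

  Finally, the images of constants under standard isometries are constant on balls of radius 2, so \<open>V\<close>
  is locally constant. Hence \<open>V\<close> is continuous and \<open>\<Delta>\<close> is itself of the standard form; a map of this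
  form does not increase the Lipschitz norm, and its inverse has the same form, so that it is a
  surjective isometry.\<close>

section \<open>The truncated metric\<close>

text \<open>Membership in \<^const>\<open>Iso_less_2\<close> means preserving the metric \<open>min d 2\<close>. In this form the condition
  is visibly stable under composition and inversion.\<close>

lemma preserves_both_iff_truncated:
  fixes \<phi> :: "'y::metric_space \<Rightarrow> 'x::metric_space"
  assumes "bij \<phi>"
  shows "preserves_dist_less_2 \<phi> \<and> preserves_dist_less_2 (inv \<phi>) \<longleftrightarrow>
    (\<forall>x y. min (dist (\<phi> x) (\<phi> y)) 2 = min (dist x y) 2)" (is "?L \<longleftrightarrow> ?R")
proof
  assume L: ?L
  show ?R
  proof (intro allI)
    fix x y
    have "dist x y < 2 \<Longrightarrow> dist (\<phi> x) (\<phi> y) = dist x y"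
      using L by (simp add: preserves_dist_less_2_def)
    moreover have "dist (\<phi> x) (\<phi> y) < 2 \<Longrightarrow> dist x y = dist (\<phi> x) (\<phi> y)"
      using L assms unfolding preserves_dist_less_2_def by (metis bij_is_inj inv_f_f)
    ultimately show "min (dist (\<phi> x) (\<phi> y)) 2 = min (dist x y) 2"
      by linarith
  qed
next
  assume R: ?R
  have 1: "dist (\<phi> x) (\<phi> y) = dist x y" if "dist (\<phi> x) (\<phi> y) < 2 \<or> dist x y < 2" for x y
    using R[rule_format, of x y] that by linarith
  have 2: "\<phi> (inv \<phi> x) = x" for x
    using assms by (simp add: bij_is_surj surj_f_inv_f)
  have "dist (inv \<phi> x) (inv \<phi> y) = dist x y" if "dist x y < 2" for x y
    using 1[of "inv \<phi> x" "inv \<phi> y"] that by (simp add: 2)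
  then show ?L
    using 1 unfolding preserves_dist_less_2_def by blast
qed

lemma Iso_less_2_iff:
  "\<phi> \<in> Iso_less_2 \<longleftrightarrow> bij \<phi> \<and> (\<forall>x y. min (dist (\<phi> x) (\<phi> y)) 2 = min (dist x y) 2)"
  using preserves_both_iff_truncated[of \<phi>] by (auto simp: Iso_less_2_def)

lemma Iso_less_2_inv:
  assumes "\<phi> \<in> Iso_less_2"
  shows "inv \<phi> \<in> Iso_less_2"
  using assms by (auto simp: Iso_less_2_def bij_imp_bij_inv inv_inv_eq)

text \<open>This is the classical fact that a compact metric space is not isometric to a proper subset of
  itself, for the truncated metric: if \<open>z\<close> lay outside the closed range, then the orbit of \<open>z\<close> would be
  uniformly discrete.\<close>

lemma truncated_isometry_of_compact_surj:
  fixes f :: "'y::metric_space \<Rightarrow> 'y"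
  assumes comp: "compact (UNIV :: 'y set)"
    and f: "\<And>x y. min (dist (f x) (f y)) 2 = min (dist x y) 2"
  shows "surj f"
proof (rule ccontr)
  assume "\<not> surj f"
  then obtain z where z: "z \<notin> range f" by blast
  have "continuous_on UNIV f"
    unfolding continuous_on_iff
  proof (intro ballI allI impI)
    fix x :: 'y and e :: real
    assume "e > 0"
    have "dist (f x') (f x) < e" if "dist x' x < min e 2" for x'
      using f[of x' x] that by linarith
    then show "\<exists>d>0. \<forall>x'\<in>UNIV. dist x' x < d \<longrightarrow> dist (f x') (f x) < e"
      using \<open>e > 0\<close> by (intro exI[of _ "min e 2"]) auto
  qed
  then have "closed (range f)"
    using comp compact_continuous_image compact_imp_closed by blast
  then have "open (- range f)"
    by (rule open_Compl)
  then obtain \<delta>' where \<delta>': "\<delta>' > 0" "\<And>w. dist w z < \<delta>' \<Longrightarrow> w \<notin> range f"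
    using z unfolding open_dist by (metis ComplD ComplI)
  define \<delta> where "\<delta> = min \<delta>' 2"
  have \<delta>: "0 < \<delta>" "\<delta> \<le> 2"
    using \<delta>'(1) by (auto simp: \<delta>_def)
  have far: "\<delta> \<le> dist z w" if "w \<in> range f" for w
    using \<delta>'(2)[of w] that by (force simp: \<delta>_def dist_commute)
  define s where "s n = (f ^^ n) z" for n
  have shift: "min (dist (s (k + m)) (s (k + n))) 2 = min (dist (s m) (s n)) 2" for k m n
    by (induction k) (auto simp: s_def f)
  have apart: "\<delta> \<le> dist (s m) (s n)" if "m < n" for m n
  proof -
    obtain j where j: "n = m + Suc j"
      using \<open>m < n\<close> less_imp_Suc_add by auto
    have "\<delta> \<le> dist (s 0) (s (Suc j))"
      using far[of "s (Suc j)"] by (simp add: s_def)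
    then show ?thesis
      using shift[of m 0 "Suc j"] \<delta>(2) j by simp
  qed
  obtain l r where r: "strict_mono r" and "(s \<circ> r) \<longlonglongrightarrow> l"
    using comp unfolding compact_def by blast
  then have "Cauchy (s \<circ> r)"
    using LIMSEQ_imp_Cauchy by blast
  then obtain N where "\<And>m n. m \<ge> N \<Longrightarrow> n \<ge> N \<Longrightarrow> dist ((s \<circ> r) m) ((s \<circ> r) n) < \<delta>"
    using \<delta>(1) unfolding Cauchy_def by blast
  then have "dist (s (r N)) (s (r (Suc N))) < \<delta>"
    by simp
  moreover have "r N < r (Suc N)"
    using r by (simp add: strict_mono_Suc_iff)
  ultimately show False
    using apart by fastforce
qed

text \<open>Distances of at least 2 are controlled by the diameter of the target.\<close>

lemma preserves_dist_less_2_imp_lipschitz: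
  fixes \<phi> :: "'y::metric_space \<Rightarrow> 'x::metric_space"
  assumes "compact (UNIV :: 'x set)" and \<phi>: "preserves_dist_less_2 \<phi>"
  shows "\<exists>C. C-lipschitz_on UNIV \<phi>"
proof -
  have "bounded (UNIV :: 'x set)"
    using assms(1) compact_imp_bounded by blast
  then obtain B where B: "\<And>u v :: 'x. dist u v \<le> B"
    unfolding bounded_two_points by auto
  have "(1 + B)-lipschitz_on UNIV \<phi>"
  proof (rule lipschitz_onI)
    have B0: "0 \<le> B"
      using B[of undefined undefined] by simp
    then show "0 \<le> 1 + B" by simp
    show "dist (\<phi> x) (\<phi> y) \<le> (1 + B) * dist x y" for x y
    proof (cases "dist x y < 2")
      case True
      then have "dist (\<phi> x) (\<phi> y) = 1 * dist x y"
        using \<phi> unfolding preserves_dist_less_2_def by simp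
      also have "\<dots> \<le> (1 + B) * dist x y"
        using B0 by (intro mult_right_mono) auto
      finally show ?thesis .
    next
      case False
      have "dist (\<phi> x) (\<phi> y) \<le> (1 + B) * 1"
        using B[of "\<phi> x" "\<phi> y"] by simp
      also have "\<dots> \<le> (1 + B) * dist x y"
        using B0 False by (intro mult_left_mono) auto
      finally show ?thesis .
    qed
  qed
  then show ?thesis ..
qed

lemma Iso_less_2_imp_Lipschitz_homeomorphism:
  fixes \<psi> :: "'y::metric_space \<Rightarrow> 'x::metric_space"
  assumes "compact (UNIV :: 'x set)" "compact (UNIV :: 'y set)" and "\<psi> \<in> Iso_less_2"
  shows "Lipschitz_homeomorphism \<psi>"
  using assms(3) preserves_dist_less_2_imp_lipschitz[OF assms(1), of \<psi>]
    preserves_dist_less_2_imp_lipschitz[OF assms(2), of "inv \<psi>"]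
  by (simp add: Lipschitz_homeomorphism_def Iso_less_2_def)

section \<open>Surjective linear isometries\<close>

lemma Iso_norm: "T \<in> Iso sE sF \<Longrightarrow> norm (T x) = norm x"
  by (simp add: Iso_def)

lemma Iso_add: "T \<in> Iso sE sF \<Longrightarrow> T (x + y) = T x + T y"
  unfolding Iso_def Vector_Spaces.linear_def by (auto dest: module_hom.add)

lemma Iso_diff: "T \<in> Iso sE sF \<Longrightarrow> T (x - y) = T x - T y"
  unfolding Iso_def Vector_Spaces.linear_def by (auto dest: module_hom.diff)

lemma Iso_scale: "T \<in> Iso sE sF \<Longrightarrow> T (sE c x) = sF c (T x)"
  unfolding Iso_def Vector_Spaces.linear_def by (auto dest: module_hom.scale)

lemma Iso_bij:
  assumes "T \<in> Iso sE sF"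
  shows "bij T"
proof (rule bijI)
  show "inj T"
  proof (rule injI)
    fix x y assume "T x = T y"
    then have "norm (T (x - y)) = 0"
      using assms by (simp add: Iso_diff)
    then show "x = y"
      using assms by (simp add: Iso_norm)
  qed
  show "surj T"
    using assms by (simp add: Iso_def)
qed

lemma Iso_inv:
  assumes T: "T \<in> Iso sE sF"
  shows "inv T \<in> Iso sF sE"
proof -
  have bij: "bij T"
    using T by (rule Iso_bij)
  have r: "T (inv T x) = x" for x
    using bij by (simp add: bij_is_surj surj_f_inv_f)
  have l: "inv T (T x) = x" for x
    using bij by (simp add: bij_is_inj)
  have "vector_space sE" "vector_space sF"
    using T by (simp_all add: Iso_def Vector_Spaces.linear_iff)
  moreover have "inv T (x + y) = inv T x + inv T y" for x y
    by (metis T Iso_add l r)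
  moreover have "inv T (sF c x) = sE c (inv T x)" for c x
    by (metis T Iso_scale l r)
  ultimately have "Vector_Spaces.linear sF sE (inv T)"
    by (simp add: Vector_Spaces.linear_iff)
  moreover have "norm (inv T x) = norm x" for x
    by (metis T Iso_norm r)
  ultimately show ?thesis
    using bij by (simp add: Iso_def bij_imp_bij_inv bij_is_surj)
qed

lemma (in normed_space_over) two_local_isometry_in_Iso:
  assumes "two_iso_reflexive scale" and "two_local_isometry scale D"
  shows "D \<in> Iso scale scale"
proof -
  have "norm (D x) = norm x" for x
    using assms(2) by (metis two_local_isometry_def Iso_norm)
  then show ?thesis
    using assms by (auto simp: Iso_def two_iso_reflexive_def)
qed

section \<open>The Lipschitz norm\<close>

lemma LipI:
  assumes "C-lipschitz_on UNIV f" and "\<And>x. norm (f x) \<le> B"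
  shows "f \<in> Lip"
  using assms unfolding Lip_def bounded_iff by auto

lemma Lip_norm_bounds:
  fixes f :: "'x::metric_space \<Rightarrow> 'e::real_normed_vector"
  assumes f: "f \<in> Lip"
  shows "norm (f x) \<le> Lip_norm f" and "norm (f x - f y) \<le> Lip_norm f * dist x y"
proof -
  have "bdd_above (range (\<lambda>x. norm (f x)))"
    using f by (simp add: Lip_def bounded_iff bdd_above_def)
  then have "norm (f x) \<le> (SUP x. norm (f x))"
    by (intro cSUP_upper) auto
  then show "norm (f x) \<le> Lip_norm f"
    by (simp add: Lip_norm_def)
  have ne: "{C. C-lipschitz_on UNIV f} \<noteq> {}"
    using f by (simp add: Lip_def)
  have "norm (f x - f y) \<le> Lip_const f * dist x y"
  proof (cases "x = y")
    case False
    have "norm (f x - f y) / dist x y \<le> Lip_const f"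
      unfolding Lip_const_def
    proof (rule cInf_greatest[OF ne])
      fix C assume "C \<in> {C. C-lipschitz_on UNIV f}"
      then have "dist (f x) (f y) \<le> C * dist x y"
        by (simp add: lipschitz_onD)
      then show "norm (f x - f y) / dist x y \<le> C"
        using False by (simp add: dist_norm divide_le_eq)
    qed
    then show ?thesis
      using False by (simp add: divide_le_eq)
  qed simp
  also have "\<dots> \<le> Lip_norm f * dist x y"
    by (intro mult_right_mono) (auto simp: Lip_norm_def)
  finally show "norm (f x - f y) \<le> Lip_norm f * dist x y" .
qed

lemma Lip_norm_le:
  fixes f :: "'x::metric_space \<Rightarrow> 'e::real_normed_vector"
  assumes "\<And>x. norm (f x) \<le> M" and "\<And>x y. norm (f x - f y) \<le> M * dist x y"
  shows "f \<in> Lip" and "Lip_norm f \<le> M"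
proof -
  have "0 \<le> M"
    using assms(1) norm_ge_zero order_trans by blast
  then have M: "M-lipschitz_on UNIV f"
    using assms(2) by (intro lipschitz_onI) (auto simp: dist_norm)
  then show "f \<in> Lip"
    using assms(1) by (rule LipI)
  have "bdd_below {C. C-lipschitz_on UNIV f}"
    using lipschitz_on_nonneg by (intro bdd_belowI[of _ 0]) auto
  then have "Lip_const f \<le> M"
    unfolding Lip_const_def using M by (intro cInf_lower) auto
  moreover have "(SUP x. norm (f x)) \<le> M"
    using assms(1) by (intro cSUP_least) auto
  ultimately show "Lip_norm f \<le> M"
    by (simp add: Lip_norm_def)
qed

lemma Lip_const_fun: "(\<lambda>_. e) \<in> Lip"
  by (rule LipI[of 0 _ "norm e"]) (auto intro: lipschitz_onI)

lemma Lip_add: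
  assumes "f \<in> Lip" "g \<in> Lip"
  shows "(\<lambda>x. f x + g x) \<in> Lip"
proof (rule Lip_norm_le(1))
  show "norm (f x + g x) \<le> Lip_norm f + Lip_norm g" for x
    using Lip_norm_bounds(1)[OF assms(1)] Lip_norm_bounds(1)[OF assms(2)]
    by (meson norm_triangle_mono)
  show "norm (f x + g x - (f y + g y)) \<le> (Lip_norm f + Lip_norm g) * dist x y" for x y
    using norm_triangle_mono[OF Lip_norm_bounds(2)[OF assms(1), of x y]
        Lip_norm_bounds(2)[OF assms(2), of x y]]
    by (simp add: algebra_simps)
qed

lemma (in normed_space_over) Lip_scale:
  assumes "f \<in> Lip"
  shows "(\<lambda>x. scale c (f x)) \<in> Lip"
proof (rule Lip_norm_le(1))
  show "norm (scale c (f x)) \<le> norm c * Lip_norm f" for x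
    using Lip_norm_bounds(1)[OF assms] by (simp add: norm_scale mult_left_mono)
  show "norm (scale c (f x) - scale c (f y)) \<le> norm c * Lip_norm f * dist x y" for x y
    using Lip_norm_bounds(2)[OF assms, of x y]
    by (simp add: norm_scale mult_left_mono mult.assoc flip: scale_right_diff_distrib)
qed

section \<open>Maps in standard form\<close>

text \<open>Agreement of \<open>J\<close> at points of distance less than 2 is the same as being constant on the
  2-components, because these are the classes of the equivalence relation generated by such pairs.\<close>

definition standard_pair ::
  "('k::real_or_complex \<Rightarrow> 'e::real_normed_vector \<Rightarrow> 'e) \<Rightarrow>
   ('k \<Rightarrow> 'f::real_normed_vector \<Rightarrow> 'f) \<Rightarrow>
   ('y::metric_space \<Rightarrow> 'x::metric_space) \<Rightarrow> ('y \<Rightarrow> 'e \<Rightarrow> 'f) \<Rightarrow> bool" where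
  "standard_pair sE sF \<phi> J \<longleftrightarrow>
    \<phi> \<in> Iso_less_2 \<and> (\<forall>y. J y \<in> Iso sE sF) \<and> (\<forall>y y'. dist y y' < 2 \<longrightarrow> J y = J y')"

lemma constant_on_two_componentsD:
  assumes "\<forall>C\<in>two_components. J constant_on C" and "dist y y' < 2"
  shows "J y = J y'"
proof -
  let ?R = "{(y, y'). dist y y' < 2}\<^sup>*"
  have "?R `` {y} \<in> two_components"
    by (simp add: two_components_def quotientI)
  moreover have "y \<in> ?R `` {y}" "y' \<in> ?R `` {y}"
    using assms(2) by auto
  ultimately show ?thesis
    using assms(1) unfolding constant_on_def by metis
qed

lemma two_local_standard_isometryE:
  assumes "two_local_standard_isometry sE sF \<Delta>" and "f \<in> Lip" "g \<in> Lip"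
  obtains \<phi> J where "standard_pair sE sF \<phi> J"
    and "\<And>y. \<Delta> f y = J y (f (\<phi> y))" and "\<And>y. \<Delta> g y = J y (g (\<phi> y))"
proof -
  obtain T where "standard_isometry sE sF T" and T: "\<Delta> f = T f" "\<Delta> g = T g"
    using assms unfolding two_local_standard_isometry_def by blast
  then obtain \<phi> J where "\<phi> \<in> Iso_less_2" "\<forall>y. J y \<in> Iso sE sF"
    and J: "\<forall>C\<in>two_components. J constant_on C"
    and "\<And>h y. h \<in> Lip \<Longrightarrow> T h y = J y (h (\<phi> y))"
    unfolding standard_isometry_def by blast
  then show ?thesis
    using that[of \<phi> J] constant_on_two_componentsD[OF J] assms(2,3) T
    by (simp add: standard_pair_def)
qed

text \<open>Two points at distance less than 2 carry the same isometry; for points further apart, the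
  trivial bound \<open>2 * M \<le> M * dist x y\<close> suffices. This is where the constant 2 comes from.\<close>

lemma standard_pair_contraction:
  fixes f :: "'x::metric_space \<Rightarrow> 'e::real_normed_vector"
  assumes sp: "standard_pair sE sF \<phi> J" and f: "f \<in> Lip"
  defines "g \<equiv> \<lambda>y. J y (f (\<phi> y))"
  shows "g \<in> Lip" and "Lip_norm g \<le> Lip_norm f"
proof -
  have J: "J y \<in> Iso sE sF" for y
    using sp by (simp add: standard_pair_def)
  have 1: "norm (g y) \<le> Lip_norm f" for y
    using Lip_norm_bounds(1)[OF f] by (simp add: g_def Iso_norm[OF J])
  have 2: "norm (g x - g y) \<le> Lip_norm f * dist x y" for x y
  proof (cases "dist x y < 2")
    case True
    then have "J x = J y" "dist (\<phi> x) (\<phi> y) = dist x y"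
      using sp by (auto simp: standard_pair_def Iso_less_2_def preserves_dist_less_2_def)
    then show ?thesis
      using Lip_norm_bounds(2)[OF f, of "\<phi> x" "\<phi> y"]
      by (simp add: g_def Iso_norm[OF J] flip: Iso_diff[OF J])
  next
    case False
    have "norm (g x - g y) \<le> Lip_norm f + Lip_norm f"
      using 1 by (meson add_mono norm_triangle_ineq4 order_trans)
    also have "\<dots> = Lip_norm f * 2"
      by simp
    also have "\<dots> \<le> Lip_norm f * dist x y"
      using False order_trans[OF norm_ge_zero 1] by (intro mult_left_mono) auto
    finally show ?thesis .
  qed
  show "g \<in> Lip" and "Lip_norm g \<le> Lip_norm f"
    using Lip_norm_le[of g "Lip_norm f"] 1 2 by auto
qed

lemma standard_pair_inv:
  assumes sp: "standard_pair sE sF \<phi> J"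
  shows "standard_pair sF sE (inv \<phi>) (\<lambda>x. inv (J (inv \<phi> x)))"
proof -
  have inv: "inv \<phi> \<in> Iso_less_2"
    using sp by (simp add: standard_pair_def Iso_less_2_inv)
  have "inv (J (inv \<phi> x)) = inv (J (inv \<phi> x'))" if "dist x x' < 2" for x x'
  proof -
    have "dist (inv \<phi> x) (inv \<phi> x') < 2"
      using inv that by (simp add: Iso_less_2_def preserves_dist_less_2_def)
    then have "J (inv \<phi> x) = J (inv \<phi> x')"
      using sp unfolding standard_pair_def by blast
    then show ?thesis
      by simp
  qed
  then show ?thesis
    using sp inv by (auto simp: standard_pair_def Iso_inv)
qed

text \<open>The inverse is given by the inverse pair, so both maps are contractions for the Lipschitz norm.\<close>

lemma standard_form_surj_linear_isometry:
  fixes sE :: "'k::real_or_complex \<Rightarrow> 'e::real_normed_vector \<Rightarrow> 'e"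
    and sF :: "'k \<Rightarrow> 'f::real_normed_vector \<Rightarrow> 'f"
    and \<Delta> :: "('x::metric_space \<Rightarrow> 'e) \<Rightarrow> ('y::metric_space \<Rightarrow> 'f)"
  assumes E: "normed_space_over sE" and sp: "standard_pair sE sF \<psi> V"
    and \<Delta>: "\<And>f y. f \<in> Lip \<Longrightarrow> \<Delta> f y = V y (f (\<psi> y))"
  shows "Lip_surj_linear_isometry sE sF \<Delta>"
proof -
  have V: "V y \<in> Iso sE sF" for y
    using sp by (simp add: standard_pair_def)
  have \<psi>: "inv \<psi> (\<psi> y) = y" "\<psi> (inv \<psi> x) = x" for x y
    using sp by (simp_all add: standard_pair_def Iso_less_2_def bij_is_inj bij_is_surj surj_f_inv_f)
  have Vinv: "inv (V y) (V y a) = a" "V y (inv (V y) b) = b" for y a b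
    using Iso_bij[OF V, of y] by (simp_all add: bij_is_inj bij_is_surj surj_f_inv_f)
  have \<Delta>eq: "\<Delta> f = (\<lambda>y. V y (f (\<psi> y)))" if "f \<in> Lip" for f
    using \<Delta>[OF that] by blast
  define S where "S g x = inv (V (inv \<psi> x)) (g (inv \<psi> x))" for g x
  have \<Delta>_Lip: "\<Delta> f \<in> Lip" "Lip_norm (\<Delta> f) \<le> Lip_norm f" if "f \<in> Lip" for f
    using standard_pair_contraction[OF sp that] that by (simp_all add: \<Delta>eq)
  have S_Lip: "S g \<in> Lip" "Lip_norm (S g) \<le> Lip_norm g" if "g \<in> Lip" for g
    using standard_pair_contraction[OF standard_pair_inv[OF sp] that] by (simp_all add: S_def[abs_def])
  have S\<Delta>: "S (\<Delta> f) = f" if "f \<in> Lip" for f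
    using that by (simp add: S_def[abs_def] \<Delta> \<psi> Vinv)
  have \<Delta>S: "\<Delta> (S g) = g" if "g \<in> Lip" for g
    using S_Lip(1)[OF that] by (simp add: \<Delta>eq S_def \<psi> Vinv)
  have "\<Delta> ` Lip = Lip"
  proof
    show "\<Delta> ` Lip \<subseteq> Lip"
      using \<Delta>_Lip by blast
    show "Lip \<subseteq> \<Delta> ` Lip"
      by (metis S_Lip(1) \<Delta>S image_eqI subsetI)
  qed
  moreover have "\<Delta> (\<lambda>x. f x + g x) = (\<lambda>y. \<Delta> f y + \<Delta> g y)" if "f \<in> Lip" "g \<in> Lip" for f g
    using that Lip_add[OF that] by (simp add: \<Delta>eq Iso_add[OF V])
  moreover have "\<Delta> (\<lambda>x. sE c (f x)) = (\<lambda>y. sF c (\<Delta> f y))" if "f \<in> Lip" for f c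
    using that normed_space_over.Lip_scale[OF E that] by (simp add: \<Delta>eq Iso_scale[OF V])
  moreover have "Lip_norm (\<Delta> f) = Lip_norm f" if "f \<in> Lip" for f
    using \<Delta>_Lip[OF that] S_Lip(2)[of "\<Delta> f"] S\<Delta>[OF that] by simp
  ultimately show ?thesis
    by (simp add: Lip_surj_linear_isometry_def)
qed

text \<open>A locally constant map is continuous for every topology on its target.\<close>

lemma standard_pair_continuous:
  fixes scale :: "'k::real_or_complex \<Rightarrow> 'e::real_normed_vector \<Rightarrow> 'e"
    and V :: "'y::metric_space \<Rightarrow> 'e \<Rightarrow> 'e"
  assumes "standard_pair scale scale \<psi> V"
  shows "continuous_map euclidean (SOT_Iso scale) V"
  unfolding continuous_map_def
proof (intro conjI allI impI)
  show "V \<in> topspace euclidean \<rightarrow> topspace (SOT_Iso scale)"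
    using assms by (simp add: standard_pair_def)
  fix U :: "('e \<Rightarrow> 'e) set"
  have "\<exists>e>0. \<forall>y'. dist y' y < e \<longrightarrow> V y' \<in> U" if "V y \<in> U" for y
    using assms that by (intro exI[of _ 2]) (auto simp: standard_pair_def)
  then show "openin euclidean {y \<in> topspace euclidean. V y \<in> U}"
    by (simp add: open_dist)
qed

section \<open>Peak functions\<close>

definition peak :: "'x::metric_space \<Rightarrow> 'e::real_normed_vector \<Rightarrow> 'x \<Rightarrow> 'e" where
  "peak x a z = max 0 (1 - dist z x) *\<^sub>R a"

lemma peak_at_center [simp]: "peak x a x = a"
  by (simp add: peak_def)

lemma peak_Lip: "peak x a \<in> Lip"
proof (rule Lip_norm_le(1))
  have "norm (peak x a z) = max 0 (1 - dist z x) * norm a" for z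
    by (simp add: peak_def)
  moreover have "max 0 (1 - dist z x) * norm a \<le> 1 * norm a" for z
    by (intro mult_right_mono) auto
  ultimately show "norm (peak x a z) \<le> norm a" for z
    by simp
  fix z w
  have "norm (peak x a z - peak x a w) = \<bar>max 0 (1 - dist z x) - max 0 (1 - dist w x)\<bar> * norm a"
    unfolding peak_def by (metis norm_scaleR scaleR_left_diff_distrib)
  also have "\<dots> \<le> dist z w * norm a"
  proof (intro mult_right_mono)
    have "dist z x \<le> dist z w + dist w x" "dist w x \<le> dist z w + dist z x"
      by (metis dist_triangle) (metis dist_commute dist_triangle)
    then show "\<bar>max 0 (1 - dist z x) - max 0 (1 - dist w x)\<bar> \<le> dist z w"
      by linarith
  qed simp
  finally show "norm (peak x a z - peak x a w) \<le> norm a * dist z w"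
    by (simp add: mult.commute)
qed

lemma peak_norm_eq_iff:
  assumes "a \<noteq> 0"
  shows "norm (peak x a z) = norm a \<longleftrightarrow> z = x"
proof
  assume "norm (peak x a z) = norm a"
  then have "max 0 (1 - dist z x) = 1"
    using assms by (simp add: peak_def)
  then show "z = x"
    by (simp add: max_def split: if_splits)
qed simp

section \<open>Reconstruction of a 2-local standard isometry\<close>

text \<open>The point \<open>\<sigma> x\<close> is where the image of one fixed peak function centred at \<open>x\<close> has maximal norm.
  Pairing this function with another peak function at \<open>x\<close>, and then the latter with an arbitrary \<open>f\<close>,
  carries the information \<open>\<phi> (\<sigma> x) = x\<close> along.\<close>

lemma peak_points:
  fixes \<Delta> :: "('x::metric_space \<Rightarrow> 'e::real_normed_vector) \<Rightarrow> ('y::metric_space \<Rightarrow> 'f::real_normed_vector)"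
  assumes \<Delta>: "two_local_standard_isometry sE sF \<Delta>" and e: "(e::'e) \<noteq> 0"
  obtains \<sigma> where
    "\<And>\<phi> J x a. standard_pair sE sF \<phi> J \<Longrightarrow> a \<noteq> 0 \<Longrightarrow>
       (\<And>y. \<Delta> (peak x a) y = J y (peak x a (\<phi> y))) \<Longrightarrow> \<phi> (\<sigma> x) = x"
proof -
  have iff: "norm (\<Delta> (peak x a) y) = norm a \<longleftrightarrow> \<phi> y = x"
    if "standard_pair sE sF \<phi> J" "a \<noteq> 0" "\<And>y. \<Delta> (peak x a) y = J y (peak x a (\<phi> y))"
    for \<phi> J x y and a :: 'e
  proof -
    have "J y \<in> Iso sE sF"
      using that(1) by (simp add: standard_pair_def)
    then show ?thesis
      using that(2,3) by (simp add: Iso_norm peak_norm_eq_iff)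
  qed
  have "\<exists>y. norm (\<Delta> (peak x e) y) = norm e" for x
  proof -
    obtain \<phi> J where sp: "standard_pair sE sF \<phi> J" "\<And>y. \<Delta> (peak x e) y = J y (peak x e (\<phi> y))"
      using two_local_standard_isometryE[OF \<Delta> peak_Lip peak_Lip] by metis
    then have "\<exists>y. \<phi> y = x"
      by (metis standard_pair_def Iso_less_2_iff bij_pointE)
    then show ?thesis
      using iff[OF sp(1) e sp(2)] by blast
  qed
  then obtain \<sigma> where \<sigma>: "\<And>x. norm (\<Delta> (peak x e) (\<sigma> x)) = norm e"
    by metis
  have \<sigma>a: "norm (\<Delta> (peak x a) (\<sigma> x)) = norm a" if "a \<noteq> 0" for x and a :: 'e
  proof -
    obtain \<phi> J where sp: "standard_pair sE sF \<phi> J"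
      "\<And>y. \<Delta> (peak x e) y = J y (peak x e (\<phi> y))" "\<And>y. \<Delta> (peak x a) y = J y (peak x a (\<phi> y))"
      using two_local_standard_isometryE[OF \<Delta> peak_Lip peak_Lip] by metis
    then show ?thesis
      using \<sigma> iff[OF sp(1) e sp(2)] iff[OF sp(1) that sp(3)] by blast
  qed
  show ?thesis
    using that[of \<sigma>] iff \<sigma>a by metis
qed

lemma two_local_standard_isometry_ex_standard_pair:
  fixes \<Delta> :: "('x::metric_space \<Rightarrow> 'e::real_normed_vector) \<Rightarrow> ('y::metric_space \<Rightarrow> 'f::real_normed_vector)"
  assumes \<Delta>: "two_local_standard_isometry sE sF \<Delta>"
  obtains \<phi> :: "'y \<Rightarrow> 'x" and J where "standard_pair sE sF \<phi> J"
proof (rule two_local_standard_isometryE[OF \<Delta> Lip_const_fun[of 0] Lip_const_fun[of 0]])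
  fix \<phi> :: "'y \<Rightarrow> 'x" and J
  assume "standard_pair sE sF \<phi> J"
  then show thesis by (rule that)
qed

text \<open>Any one of the given bijections \<open>Y \<rightarrow> X\<close>, followed by \<open>\<sigma>\<close>, is a self-map of the compact space \<open>Y\<close>;
  this yields surjectivity.\<close>

lemma peak_points_Iso_less_2:
  fixes \<Delta> :: "('x::metric_space \<Rightarrow> 'e::real_normed_vector) \<Rightarrow> ('y::metric_space \<Rightarrow> 'f::real_normed_vector)"
  assumes \<Delta>: "two_local_standard_isometry sE sF \<Delta>" and e: "(e::'e) \<noteq> 0"
    and compact: "compact (UNIV :: 'y set)"
    and \<sigma>: "\<And>\<phi> J x a. standard_pair sE sF \<phi> J \<Longrightarrow> a \<noteq> 0 \<Longrightarrow>
       (\<And>y. \<Delta> (peak x a) y = J y (peak x a (\<phi> y))) \<Longrightarrow> \<phi> (\<sigma> x) = x"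
  shows "\<sigma> \<in> Iso_less_2"
proof -
  have trunc: "min (dist (\<sigma> x) (\<sigma> x')) 2 = min (dist x x') 2" for x x'
  proof -
    obtain \<phi> J where sp: "standard_pair sE sF \<phi> J"
      "\<And>y. \<Delta> (peak x e) y = J y (peak x e (\<phi> y))" "\<And>y. \<Delta> (peak x' e) y = J y (peak x' e (\<phi> y))"
      using two_local_standard_isometryE[OF \<Delta> peak_Lip peak_Lip] by metis
    have "\<phi> (\<sigma> x) = x" "\<phi> (\<sigma> x') = x'"
      using \<sigma>[OF sp(1) e] sp(2,3) by auto
    then show ?thesis
      using sp(1) by (metis standard_pair_def Iso_less_2_iff)
  qed
  have "inj \<sigma>"
  proof (rule injI)
    fix x x' assume "\<sigma> x = \<sigma> x'"
    then have "min (dist x x') 2 = 0"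
      using trunc[of x x'] by simp
    then show "x = x'"
      by (simp add: min_def split: if_splits)
  qed
  moreover have "surj \<sigma>"
  proof -
    obtain \<phi> :: "'y \<Rightarrow> 'x" and J where "standard_pair sE sF \<phi> J"
      by (rule two_local_standard_isometry_ex_standard_pair[OF \<Delta>])
    then have "min (dist (\<sigma> (\<phi> y)) (\<sigma> (\<phi> y'))) 2 = min (dist y y') 2" for y y'
      by (simp add: trunc standard_pair_def Iso_less_2_iff)
    then have "surj (\<lambda>y. \<sigma> (\<phi> y))"
      by (rule truncated_isometry_of_compact_surj[OF compact])
    then show ?thesis
      by (fastforce simp: surj_def)
  qed
  ultimately show ?thesis
    by (intro Iso_less_2_iff[THEN iffD2] conjI bijI allI trunc)
qed

text \<open>The value of \<open>\<Delta> f\<close> at \<open>\<sigma> x\<close> depends on \<open>f x\<close> only, since \<open>f\<close> can be compared with a peak function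
  at \<open>x\<close> of the same central value. The zero vector admits no peak function, but there the norm decides.\<close>

lemma value_at_peak_point:
  fixes \<Delta> :: "('x::metric_space \<Rightarrow> 'e::real_normed_vector) \<Rightarrow> ('y::metric_space \<Rightarrow> 'f::real_normed_vector)"
  assumes \<Delta>: "two_local_standard_isometry sE sF \<Delta>" and e: "(e::'e) \<noteq> 0" and f: "f \<in> Lip"
    and \<sigma>: "\<And>\<phi> J x a. standard_pair sE sF \<phi> J \<Longrightarrow> a \<noteq> 0 \<Longrightarrow>
       (\<And>y. \<Delta> (peak x a) y = J y (peak x a (\<phi> y))) \<Longrightarrow> \<phi> (\<sigma> x) = x"
  shows "\<Delta> f (\<sigma> x) = \<Delta> (\<lambda>_. f x) (\<sigma> x)"
proof (cases "f x = 0")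
  case True
  have zero: "\<Delta> g (\<sigma> x) = 0" if g: "g \<in> Lip" "g x = 0" for g
  proof -
    obtain \<phi> J where sp: "standard_pair sE sF \<phi> J"
      "\<And>y. \<Delta> g y = J y (g (\<phi> y))" "\<And>y. \<Delta> (peak x e) y = J y (peak x e (\<phi> y))"
      using two_local_standard_isometryE[OF \<Delta> g(1) peak_Lip] by metis
    have "J (\<sigma> x) \<in> Iso sE sF"
      using sp(1) by (simp add: standard_pair_def)
    then have "norm (\<Delta> g (\<sigma> x)) = norm (g x)"
      using \<sigma>[OF sp(1) e sp(3)] by (simp add: sp(2) Iso_norm)
    then show ?thesis
      using g(2) by simp
  qed
  show ?thesis
    using zero[OF f True] zero[OF Lip_const_fun[of "f x"] True] by simp
next
  case False
  have same: "\<Delta> g (\<sigma> x) = \<Delta> (peak x (f x)) (\<sigma> x)" if g: "g \<in> Lip" "g x = f x" for g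
  proof -
    obtain \<phi> J where sp: "standard_pair sE sF \<phi> J"
      "\<And>y. \<Delta> g y = J y (g (\<phi> y))" "\<And>y. \<Delta> (peak x (f x)) y = J y (peak x (f x) (\<phi> y))"
      using two_local_standard_isometryE[OF \<Delta> g(1) peak_Lip] by metis
    show ?thesis
      using \<sigma>[OF sp(1) False sp(3)] by (simp add: sp(2,3) g(2))
  qed
  show ?thesis
    using same[OF f] same[OF Lip_const_fun[of "f x"]] by simp
qed

text \<open>A standard isometry sends the constant \<open>a\<close> to \<open>y \<mapsto> J y a\<close>, whatever its bijection is. Hence evaluating
  the images of constants at \<open>y\<close> is a 2-local isometry of \<open>E\<close>, and for each fixed \<open>a\<close> these values inherit
  local constancy from \<open>J\<close>, although \<open>J\<close> depends on \<open>a\<close>.\<close>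

lemma values_of_constants:
  fixes scale :: "'k::real_or_complex \<Rightarrow> 'e::real_normed_vector \<Rightarrow> 'e"
    and \<Delta> :: "('x::metric_space \<Rightarrow> 'e) \<Rightarrow> ('y::metric_space \<Rightarrow> 'e)"
  assumes E: "normed_space_over scale" "two_iso_reflexive scale"
    and \<Delta>: "two_local_standard_isometry scale scale \<Delta>"
  shows "(\<lambda>a. \<Delta> (\<lambda>_. a) y) \<in> Iso scale scale"
    and "dist y y' < 2 \<Longrightarrow> \<Delta> (\<lambda>_. a) y = \<Delta> (\<lambda>_. a) y'"
proof -
  have "two_local_isometry scale (\<lambda>a. \<Delta> (\<lambda>_. a) y)"
    unfolding two_local_isometry_def
  proof (intro allI)
    fix a b
    show "\<exists>T\<in>Iso scale scale. \<Delta> (\<lambda>_. a) y = T a \<and> \<Delta> (\<lambda>_. b) y = T b"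
    proof (rule two_local_standard_isometryE[OF \<Delta> Lip_const_fun[of a] Lip_const_fun[of b]])
      fix \<phi> :: "'y \<Rightarrow> 'x" and J
      assume "standard_pair scale scale \<phi> J" "\<And>y. \<Delta> (\<lambda>_. a) y = J y a" "\<And>y. \<Delta> (\<lambda>_. b) y = J y b"
      then show ?thesis
        by (intro bexI[of _ "J y"]) (auto simp: standard_pair_def)
    qed
  qed
  then show "(\<lambda>a. \<Delta> (\<lambda>_. a) y) \<in> Iso scale scale"
    by (rule normed_space_over.two_local_isometry_in_Iso[OF E])
  show "\<Delta> (\<lambda>_. a) y = \<Delta> (\<lambda>_. a) y'" if "dist y y' < 2"
  proof (rule two_local_standard_isometryE[OF \<Delta> Lip_const_fun[of a] Lip_const_fun[of a]])
    fix \<phi> :: "'y \<Rightarrow> 'x" and J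
    assume "standard_pair scale scale \<phi> J" and \<Delta>a: "\<And>y. \<Delta> (\<lambda>_. a) y = J y a"
    then have "J y = J y'"
      using that unfolding standard_pair_def by blast
    then show ?thesis
      by (simp add: \<Delta>a)
  qed
qed

lemma two_local_standard_isometry_standard_form:
  fixes scale :: "'k::real_or_complex \<Rightarrow> 'e::real_normed_vector \<Rightarrow> 'e"
    and \<Delta> :: "('x::metric_space \<Rightarrow> 'e) \<Rightarrow> ('y::metric_space \<Rightarrow> 'e)"
  assumes compact: "compact (UNIV :: 'y set)"
    and E: "normed_space_over scale" "two_iso_reflexive scale"
    and \<Delta>: "two_local_standard_isometry scale scale \<Delta>"
  obtains \<psi> V where "standard_pair scale scale \<psi> V"
    and "\<And>f y. f \<in> Lip \<Longrightarrow> \<Delta> f y = V y (f (\<psi> y))"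
proof (cases "\<exists>e::'e. e \<noteq> 0")
  case True
  then obtain e :: 'e where e: "e \<noteq> 0" ..
  obtain \<sigma> where \<sigma>: "\<And>\<phi> J x a. standard_pair scale scale \<phi> J \<Longrightarrow> a \<noteq> 0 \<Longrightarrow>
       (\<And>y. \<Delta> (peak x a) y = J y (peak x a (\<phi> y))) \<Longrightarrow> \<phi> (\<sigma> x) = x"
    using peak_points[OF \<Delta> e] by blast
  have iso: "\<sigma> \<in> Iso_less_2"
    using \<Delta> e compact \<sigma> by (rule peak_points_Iso_less_2)
  define V where "V y a = \<Delta> (\<lambda>_. a) y" for y a
  have "standard_pair scale scale (inv \<sigma>) V"
    using values_of_constants[OF E \<Delta>] Iso_less_2_inv[OF iso]
    by (auto simp: standard_pair_def V_def[abs_def])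
  moreover have "\<Delta> f y = V y (f (inv \<sigma> y))" if "f \<in> Lip" for f y
  proof -
    have "\<Delta> f (\<sigma> x) = \<Delta> (\<lambda>_. f x) (\<sigma> x)" for x
      using \<Delta> e that \<sigma> by (rule value_at_peak_point)
    moreover have "\<sigma> (inv \<sigma> y) = y"
      using iso by (simp add: Iso_less_2_def bij_is_surj surj_f_inv_f)
    ultimately show ?thesis
      unfolding V_def by metis
  qed
  ultimately show ?thesis
    using that by blast
next
  case False
  \<comment> \<open>There are no peak functions when \<open>E\<close> is trivial, but then any pair will do.\<close>
  then have triv: "a = b" for a b :: 'e
    by metis
  obtain \<phi> :: "'y \<Rightarrow> 'x" and J where "standard_pair scale scale \<phi> J"
    by (rule two_local_standard_isometry_ex_standard_pair[OF \<Delta>])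
  then show ?thesis
    by (rule that) (rule triv)
qed

theorem theorem2p7:
  fixes scale :: "'k::real_or_complex \<Rightarrow> 'e::banach \<Rightarrow> 'e"
    and \<Delta> :: "('x::metric_space \<Rightarrow> 'e) \<Rightarrow> ('y::metric_space \<Rightarrow> 'e)"
  assumes "compact (UNIV :: 'x set)" and "compact (UNIV :: 'y set)"
    and "normed_space_over scale"
    and "smooth_space scale" and "reflexive_space scale" and "two_iso_reflexive scale"
    and "two_local_standard_isometry scale scale \<Delta>"
  shows "(\<exists>(\<psi> :: 'y \<Rightarrow> 'x) V. Lipschitz_homeomorphism \<psi> \<and>
            continuous_map euclidean (SOT_Iso scale) V \<and>
            (\<forall>y. \<forall>f\<in>Lip. \<Delta> f y = V y (f (\<psi> y)))) \<and>
         Lip_surj_linear_isometry scale scale \<Delta>"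
proof -
  obtain \<psi> V where sp: "standard_pair scale scale \<psi> V"
    and \<Delta>: "\<And>f y. f \<in> Lip \<Longrightarrow> \<Delta> f y = V y (f (\<psi> y))"
    using two_local_standard_isometry_standard_form[OF assms(2,3,6,7)] by blast
  have "Lipschitz_homeomorphism \<psi>"
    using sp assms(1,2) by (simp add: standard_pair_def Iso_less_2_imp_Lipschitz_homeomorphism)
  moreover have "continuous_map euclidean (SOT_Iso scale) V"
    using sp by (rule standard_pair_continuous)
  moreover have "Lip_surj_linear_isometry scale scale \<Delta>"
    using assms(3) sp \<Delta> by (rule standard_form_surj_linear_isometry)
  ultimately show ?thesis
    using \<Delta> by blast
qed

end
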